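(* Let $b,p,c\in\mathbb{C}$, let $\kappa=p+(b+1)/2$, and suppose that $$\sqrt{3}\,|\kappa-3|+\frac{|c|}{4}<\sqrt{\frac{9}{8}+\frac{1}{\sqrt{2}}}.$$ Let $u_p(z)=u_{p,b,c}(z)=\sum_{n\ge 0}\frac{(-c/4)^n}{(\kappa)_n}\frac{z^n}{n!}$ be the generalized and "normalized" Bessel function. Then the function $z\mapsto z\,u_p(z)$ is lemniscate starlike in $\mathbb{D}$.
   Context: $\mathbb{D}=\{z\in\mathbb{C}:|z|<1\}$. For analytic functions $f,g$ on $\mathbb{D}$, $f\prec g$ ($f$ is subordinate to $g$) means that there is an analytic $w:\mathbb{D}\to\mathbb{D}$ with $w(0)=0$ and $f=g\circ w$. $\sqrt{1+z}$ denotes the principal branch (value $1$ at $z=0$). An analytic function $f$ on $\mathbb{D}$ with $f(0)=0$, $f'(0)=1$ is called lemniscate starlike if $\frac{zf'(z)}{f(z)}$ is analytic in $\mathbb{D}$ (with removable singularity at $0$) and $\frac{zf'(z)}{f(z)}\prec\sqrt{1+z}$. $(\lambda)_n=\lambda(\lambda+1)\cdots(\lambda+n-1)$, $(\lambda)_0=1$, is the Pochhammer symbol. The function $u_p$ is defined for $\kappa\neq 0,-1,-2,\ldots$ and is entire. *)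

theory Defs
  imports "HOL-Analysis.Analysis"
begin

abbreviation unit_disk :: "complex set"
  where "unit_disk \<equiv> ball 0 1"

definition subordinate :: "(complex \<Rightarrow> complex) \<Rightarrow> (complex \<Rightarrow> complex) \<Rightarrow> bool"
  where "subordinate f g \<longleftrightarrow>
    f analytic_on unit_disk \<and> g analytic_on unit_disk \<and>
    (\<exists>w. w analytic_on unit_disk \<and> w ` unit_disk \<subseteq> unit_disk \<and> w 0 = 0 \<and>
         (\<forall>z\<in>unit_disk. f z = g (w z)))"

text \<open>
  The function \<open>q\<close> is the analytic extension of \<open>z f'(z) / f(z)\<close> across the removable
  singularity at \<open>0\<close>. Away from \<open>0\<close> the quotient has to be genuinely defined, so \<open>f z \<noteq> 0\<close>
  is required there; otherwise the convention \<open>x / 0 = 0\<close> would come into play.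
\<close>
definition lemniscate_starlike :: "(complex \<Rightarrow> complex) \<Rightarrow> bool"
  where "lemniscate_starlike f \<longleftrightarrow>
    f analytic_on unit_disk \<and> f 0 = 0 \<and> deriv f 0 = 1 \<and>
    (\<exists>q. q analytic_on unit_disk \<and>
         (\<forall>z\<in>unit_disk - {0}. f z \<noteq> 0 \<and> q z = z * deriv f z / f z) \<and>
         subordinate q (\<lambda>z. csqrt (1 + z)))"

text \<open>
  The generalized and normalized Bessel function, with \<open>\<kappa> = p + (b + 1) / 2\<close>. It is
  meaningful only if \<open>\<kappa>\<close> is not a nonpositive integer, since otherwise some of the
  denominators vanish.
\<close>
definition gen_bessel :: "complex \<Rightarrow> complex \<Rightarrow> complex \<Rightarrow> complex \<Rightarrow> complex"
  where "gen_bessel p b c z =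
    (\<Sum>n. (- c / 4) ^ n / pochhammer (p + (b + 1) / 2) n * (z ^ n / fact n))"

end

theory Submission
  imports Defs "HOL-Complex_Analysis.Complex_Analysis"
begin

text \<open>
  Put \<open>q = 1 + z u'/u\<close> and \<open>w = q\<^sup>2 - 1\<close>; the claim is \<open>\<bar>w\<bar> < 1\<close> and \<open>Re q > 0\<close>. The Bessel equation
  turns into the Riccati equation \<open>z q' + (q\<^sup>2 - 1) + (\<kappa> - 3) (q - 1) = - c z / 4\<close>.
  At a point of minimal modulus where the claim fails, \<open>\<bar>w\<bar> = 1\<close>, and Jack's lemma gives
  \<open>z w' = m w\<close> with a real \<open>m \<ge> 1\<close>. Hence \<open>q \<noteq> 0\<close>, and
  \<open>w (1 + m / (2 q)) = - c z / 4 - (\<kappa> - 3) (q - 1)\<close>. On the lemniscate \<open>Re (1 / q) \<ge> 1 / \<surd>2\<close>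
  and \<open>\<bar>q - 1\<bar> \<le> 1\<close>, so \<open>1 + 1 / (2 \<surd>2) \<le> \<bar>c\<bar> / 4 + \<bar>\<kappa> - 3\<bar>\<close>. This is
  impossible because \<open>(1 + 1 / (2 \<surd>2))\<^sup>2 = 9 / 8 + 1 / \<surd>2\<close>.
\<close>

section \<open>A differential inequality that excludes zeros\<close>

lemma has_real_derivative_norm_power2:
  fixes f :: "real \<Rightarrow> 'a::real_inner"
  assumes "(f has_vector_derivative D) (at t)"
  shows "((\<lambda>t. (norm (f t))\<^sup>2) has_real_derivative 2 * (f t \<bullet> D)) (at t)"
proof -
  have "((\<lambda>t. f t \<bullet> f t) has_derivative (\<lambda>h. f t \<bullet> (h *\<^sub>R D) + (h *\<^sub>R D) \<bullet> f t)) (at t)"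
    using assms unfolding has_vector_derivative_def
    by (intro has_derivative_inner)
  moreover have "(\<lambda>h. f t \<bullet> (h *\<^sub>R D) + (h *\<^sub>R D) \<bullet> f t) = (*) (2 * (f t \<bullet> D))"
    by (auto simp: inner_commute)
  ultimately show ?thesis
    by (simp add: has_field_derivative_def power2_norm_eq_inner)
qed

text \<open>By Cauchy-Schwarz the weight \<open>exp (2 * C * t)\<close> makes
  \<open>(norm (f t))\<^sup>2 * exp (2 * C * t)\<close> nondecreasing, so it stays positive. The
  bound is assumed only on the open interval, since in the application it is known only before the
  endpoint is reached.\<close>

lemma gronwall_nonzero:
  fixes f :: "real \<Rightarrow> 'a::real_inner"
  assumes "a \<le> b"
    and der: "\<And>t. a \<le> t \<Longrightarrow> t \<le> b \<Longrightarrow> (f has_vector_derivative f' t) (at t)"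
    and bound: "\<And>t. a < t \<Longrightarrow> t < b \<Longrightarrow> norm (f' t) \<le> C * norm (f t)"
    and "f a \<noteq> 0"
  shows "f b \<noteq> 0"
proof -
  define g where "g t = (norm (f t))\<^sup>2 * exp (2 * C * t)" for t
  define g' where "g' t = (2 * (f t \<bullet> f' t) + 2 * C * (norm (f t))\<^sup>2) * exp (2 * C * t)" for t
  have g: "(g has_real_derivative g' t) (at t)" if "a \<le> t" "t \<le> b" for t
    unfolding g_def g'_def
    by (rule derivative_eq_intros has_real_derivative_norm_power2 der refl that)+
       (simp add: algebra_simps)
  have "g' t \<ge> 0" if "a < t" "t < b" for t
  proof -
    have "\<bar>f t \<bullet> f' t\<bar> \<le> norm (f t) * norm (f' t)"
      by (rule Cauchy_Schwarz_ineq2)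
    also have "\<dots> \<le> norm (f t) * (C * norm (f t))"
      using bound[OF that] by (intro mult_left_mono) auto
    finally have "0 \<le> 2 * (f t \<bullet> f' t) + 2 * C * (norm (f t))\<^sup>2"
      by (simp add: power2_eq_square abs_le_iff mult_ac)
    then show ?thesis by (simp add: g'_def)
  qed
  then have "g a \<le> g b"
    using \<open>a \<le> b\<close> g
    by (intro DERIV_nonneg_imp_increasing_open[of a b g])
       (auto intro!: continuous_at_imp_continuous_on DERIV_isCont less_imp_le | meson less_imp_le)+
  moreover have "g a > 0"
    using \<open>f a \<noteq> 0\<close> by (simp add: g_def)
  ultimately show ?thesis
    by (auto simp: g_def)
qed

section \<open>The lemmas of Schwarz and Jack\<close>

lemma Schwarz_Lemma_ball:
  assumes hol: "w holomorphic_on ball 0 r" and "w 0 = 0" and "r > 0"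
    and less: "\<And>z. norm z < r \<Longrightarrow> norm (w z) < 1"
    and "norm z < r"
  shows "norm (w z) \<le> norm z / r"
proof -
  have img: "(\<lambda>z. of_real r * z) ` ball 0 1 \<subseteq> ball (0::complex) r"
    using \<open>r > 0\<close> by (auto simp: norm_mult)
  have "norm ((\<lambda>z. w (of_real r * z)) (z / of_real r)) \<le> norm (z / of_real r)"
  proof (rule Schwarz_Lemma)
    show "(\<lambda>z. w (of_real r * z)) holomorphic_on ball 0 1"
      using holomorphic_on_compose_gen[OF _ hol img] by (auto simp: o_def intro!: holomorphic_intros)
  qed (use assms in \<open>auto simp: norm_mult norm_divide\<close>)
  then show ?thesis
    using \<open>r > 0\<close> by (simp add: norm_divide)
qed

text \<open>The radial derivative of the squared modulus at \<open>z0\<close> is at least 2 by the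
  Schwarz lemma, and the tangential one vanishes because the modulus is maximal there. Together they
  say that \<open>cnj (w z0) * (z0 * D)\<close> is real and at least 1.\<close>

lemma Jack:
  assumes hol: "w holomorphic_on ball 0 (norm z0)" and w0: "w 0 = 0"
    and less: "\<And>z. norm z < norm z0 \<Longrightarrow> norm (w z) < 1"
    and wz0: "norm (w z0) = 1"
    and D: "(w has_field_derivative D) (at z0)"
  obtains m :: real where "m \<ge> 1" "z0 * D = of_real m * w z0"
proof -
  have z0: "z0 \<noteq> 0" using w0 wz0 by auto
  have vec: "((\<lambda>t. w (\<gamma> t)) has_vector_derivative (v * D)) (at t)"
    if "(\<gamma> has_vector_derivative v) (at t)" "\<gamma> t = z0" for \<gamma> :: "real \<Rightarrow> complex" and v t
    using field_vector_diff_chain_at[OF that(1), of w D] D that(2) by (simp add: o_def)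
  have re: "w z0 \<bullet> (z0 * D) \<ge> 1"
  proof (rule ccontr)
    assume *: "\<not> ?thesis"
    \<comment> \<open>The Schwarz lemma gives \<open>h t \<le> 0\<close> just before
      \<open>t = 1\<close>, where \<open>h\<close> vanishes; a negative derivative at 1 would force
      positive values there.\<close>
    define h where "h t = (norm (w (of_real t * z0)))\<^sup>2 - t\<^sup>2" for t :: real
    have "((\<lambda>t. w (of_real t * z0)) has_vector_derivative (z0 * D)) (at 1)"
      by (rule vec) (auto intro!: derivative_eq_intros)
    from DERIV_diff[OF has_real_derivative_norm_power2[OF this] DERIV_power[OF DERIV_ident, of 2]]
    have "(h has_real_derivative (2 * (w z0 \<bullet> (z0 * D)) - 2)) (at 1)"
      by (simp add: h_def[abs_def])
    from DERIV_neg_dec_left[OF this] * obtain d where d: "d > 0" "\<And>e. 0 < e \<Longrightarrow> e < d \<Longrightarrow> h 1 < h (1 - e)"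
      by auto
    define e where "e = min (d / 2) (1 / 2)"
    have e: "0 < e" "e < d" "e < 1" using d(1) by (auto simp: e_def)
    have "norm (of_real (1 - e) * z0) < norm z0"
      using e z0 by (simp add: norm_mult del: of_real_diff)
    from Schwarz_Lemma_ball[OF hol w0 _ less this]
    have "norm (w (of_real (1 - e) * z0)) \<le> 1 - e"
      using z0 e by (simp add: norm_mult del: of_real_diff)
    then have "h (1 - e) \<le> 0"
      unfolding h_def by (simp add: power_mono del: of_real_diff)
    moreover have "h 1 = 0" using wz0 by (simp add: h_def)
    ultimately show False using d(2)[OF e(1,2)] by simp
  qed
  have im: "w z0 \<bullet> (\<i> * z0 * D) = 0"
  proof -
    \<comment> \<open>This curve touches the circle of radius \<open>\<bar>z0\<bar>\<close> from inside, so no bound on the circle itself is needed.\<close>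
    define \<gamma> :: "real \<Rightarrow> complex" where "\<gamma> t = z0 / (1 - \<i> * of_real t)" for t
    have "(\<gamma> has_vector_derivative (\<i> * z0)) (at 0)"
      unfolding \<gamma>_def has_vector_derivative_def by (auto intro!: derivative_eq_intros simp: scaleR_conv_of_real)
    from has_real_derivative_norm_power2[OF vec[OF this]]
    have der: "((\<lambda>t. (norm (w (\<gamma> t)))\<^sup>2) has_real_derivative 2 * (w z0 \<bullet> (\<i> * z0 * D))) (at 0)"
      by (simp add: \<gamma>_def)
    have "norm (w (\<gamma> t)) \<le> 1" for t
    proof (cases "t = 0")
      case False
      have "norm (1 - \<i> * of_real t) > 1"
        using False by (simp add: cmod_def)
      then have "norm (\<gamma> t) < norm z0"
        using z0 by (simp add: \<gamma>_def norm_divide field_simps)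
      then show ?thesis using less by (simp add: less_imp_le)
    qed (use wz0 in \<open>simp add: \<gamma>_def\<close>)
    then have "\<forall>t. \<bar>0 - t\<bar> < 1 \<longrightarrow> (norm (w (\<gamma> t)))\<^sup>2 \<le> (norm (w (\<gamma> 0)))\<^sup>2"
      using wz0 by (simp add: \<gamma>_def power_le_one)
    from DERIV_local_max[OF der _ this] show ?thesis by simp
  qed
  have cnj: "cnj (w z0) * w z0 = 1"
    using wz0 by (metis complex_norm_square mult.commute of_real_1 one_power2)
  define m where "m = w z0 \<bullet> (z0 * D)"
  \<comment> \<open>The inner product in \<open>im\<close> is minus the imaginary part of the
    left-hand side, and \<open>m\<close> is its real part.\<close>
  have "cnj (w z0) * (z0 * D) = of_real m"
    using im by (simp add: m_def complex_eq_iff inner_complex_def algebra_simps)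
  then have "z0 * D = of_real m * w z0"
    by (metis cnj mult.assoc mult.commute mult.left_neutral)
  with re show ?thesis using that m_def by blast
qed

section \<open>Geometry of the right half of the lemniscate\<close>

text \<open>The first bound follows from \<open>norm (q - 1) * norm (q + 1) = 1\<close>. For the
  second, put \<open>s = (norm q)\<^sup>2\<close>: the curve is
  \<open>4 * (Re q)\<^sup>2 = s * (s + 2)\<close> with \<open>s \<le> 2\<close>, hence
  \<open>s \<le> sqrt 2 * Re q\<close>, and \<open>Re (1 / q) = Re q / s\<close>.\<close>

lemma lemniscate_bounds:
  fixes q :: complex
  assumes q: "norm (q\<^sup>2 - 1) = 1" and "Re q \<ge> 0"
  shows "norm (q - 1) \<le> 1" and "q \<noteq> 0 \<Longrightarrow> Re (1 / q) \<ge> 1 / sqrt 2"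
proof -
  have "norm (q - 1) * norm (q + 1) = 1"
    using q by (simp add: norm_mult[symmetric] power2_eq_square algebra_simps)
  moreover have "norm (q + 1) \<ge> 1"
    using complex_Re_le_cmod[of "q + 1"] \<open>Re q \<ge> 0\<close> by simp
  ultimately show "norm (q - 1) \<le> 1"
    by (metis mult_left_mono mult.right_neutral norm_ge_zero)
next
  assume "q \<noteq> 0"
  define s where "s = (norm q)\<^sup>2"
  have "s > 0" using \<open>q \<noteq> 0\<close> by (simp add: s_def)
  have "s \<le> 2"
    using norm_triangle_ineq[of "q\<^sup>2 - 1" 1] q by (simp add: s_def norm_power)
  have "(norm (q\<^sup>2 - 1))\<^sup>2 = s\<^sup>2 + 2 * s - 4 * (Re q)\<^sup>2 + 1"
    unfolding s_def cmod_power2 by (simp add: power2_eq_square algebra_simps)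
  then have "4 * (Re q)\<^sup>2 = s * (s + 2)"
    using q by (simp add: power2_eq_square algebra_simps)
  also have "\<dots> \<ge> s * (2 * s)"
    using \<open>s > 0\<close> \<open>s \<le> 2\<close> by (intro mult_left_mono) auto
  finally have "s\<^sup>2 \<le> (sqrt 2 * Re q)\<^sup>2"
    by (simp add: power2_eq_square power_mult_distrib algebra_simps)
  then have "s \<le> sqrt 2 * Re q"
    by (rule power2_le_imp_le) (use \<open>Re q \<ge> 0\<close> in simp)
  then have "1 / sqrt 2 \<le> Re q / s"
    using \<open>s > 0\<close> by (simp add: field_simps)
  also have "\<dots> = Re (1 / q)"
    by (simp add: s_def Re_divide cmod_power2)
  finally show "Re (1 / q) \<ge> 1 / sqrt 2" .
qed

lemma sqrt_bound_eq: "sqrt (9 / 8 + 1 / sqrt 2) = 1 + 1 / (2 * sqrt 2)"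
  by (rule real_sqrt_unique) (auto simp: power2_eq_square field_simps)

section \<open>The minimal-modulus argument for solutions of the Bessel equation\<close>

text \<open>The nonvanishing of \<open>u\<close> is proved together with the two inequalities,
  because the quotient is meaningful only where \<open>u\<close> is nonzero and the inequalities
  before a possible zero are what exclude it.\<close>

lemma bessel_ode_lemniscate:
  fixes u u1 u2 :: "complex \<Rightarrow> complex" and \<kappa> c :: complex
  assumes u: "\<And>z. (u has_field_derivative u1 z) (at z)"
    and u1: "\<And>z. (u1 has_field_derivative u2 z) (at z)"
    and ode: "\<And>z. z * u2 z + \<kappa> * u1 z + c / 4 * u z = 0"
    and "u 0 = 1"
    and small: "norm (\<kappa> - 3) + norm c / 4 < 1 + 1 / (2 * sqrt 2)"
    and "norm z < 1"
  shows "u z \<noteq> 0 \<and> norm ((1 + z * u1 z / u z)\<^sup>2 - 1) < 1 \<and> 0 < Re (1 + z * u1 z / u z)"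
proof (rule ccontr)
  assume bad: "\<not> ?thesis"
  define q where "q z = 1 + z * u1 z / u z" for z
  define q' where "q' z = (u1 z + z * u2 z) / u z - z * (u1 z)\<^sup>2 / (u z)\<^sup>2" for z
  define U where "U = {z. u z \<noteq> 0}"
  define A where "A = {z \<in> U. q z \<in> {v. norm (v\<^sup>2 - 1) < 1 \<and> 0 < Re v}}"
  have q: "(q has_field_derivative q' z) (at z)" if "u z \<noteq> 0" for z
    unfolding q_def q'_def using that
    by (auto intro!: derivative_eq_intros u u1 simp: field_simps power2_eq_square)
  have riccati: "z * q' z + ((q z)\<^sup>2 - 1) + (\<kappa> - 3) * (q z - 1) = - (c * z / 4)" if "u z \<noteq> 0" for z
  proof -
    have u2: "z * u2 z = - (\<kappa> * u1 z) - c / 4 * u z"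
      using ode[of z] by (simp add: algebra_simps eq_neg_iff_add_eq_0)
    show ?thesis
      unfolding q_def q'_def u2 using that by (simp add: field_simps power2_eq_square)
  qed
  have "continuous_on UNIV u"
    by (auto intro!: continuous_at_imp_continuous_on DERIV_isCont u)
  then have "open U"
    unfolding U_def by (intro open_Collect_neq) auto
  have "continuous_on U q"
    by (auto intro!: continuous_at_imp_continuous_on DERIV_isCont q simp: U_def)
  moreover have "open {v::complex. norm (v\<^sup>2 - 1) < 1 \<and> 0 < Re v}"
    by (intro open_Collect_conj open_Collect_less continuous_intros)
  ultimately have "open (U \<inter> q -` {v. norm (v\<^sup>2 - 1) < 1 \<and> 0 < Re v})"
    using \<open>open U\<close> by (intro continuous_open_preimage)
  then have "open A"
    unfolding A_def by (simp add: vimage_def Int_def)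
  have "z \<in> cball 0 (norm z) - A"
    using bad by (auto simp: A_def U_def q_def)
  moreover have "compact (cball 0 (norm z) - A)"
    using \<open>open A\<close> by (intro compact_diff) auto
  moreover have "continuous_on (cball 0 (norm z) - A) norm"
    by (intro continuous_intros)
  ultimately obtain z0 where z0: "z0 \<in> cball 0 (norm z) - A"
    and min: "\<And>y. y \<in> cball 0 (norm z) - A \<Longrightarrow> norm z0 \<le> norm y"
    using continuous_attains_inf[of "cball 0 (norm z) - A" norm] by (metis empty_iff)
  have "z0 \<notin> A" "norm z0 < 1"
    using z0 \<open>norm z < 1\<close> by auto
  have below: "u y \<noteq> 0" "norm ((q y)\<^sup>2 - 1) < 1" "0 < Re (q y)" if "norm y < norm z0" for y
  proof -
    have "y \<in> A" using min[of y] that z0 by force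
    then show "u y \<noteq> 0" "norm ((q y)\<^sup>2 - 1) < 1" "0 < Re (q y)" by (auto simp: A_def U_def)
  qed
  have "q 0 = 1" by (simp add: q_def)
  have "z0 \<noteq> 0"
    using \<open>z0 \<notin> A\<close> \<open>u 0 = 1\<close> \<open>q 0 = 1\<close> by (auto simp: A_def U_def)
  \<comment> \<open>At a zero of \<open>u\<close> the convention \<open>x / 0 = 0\<close> would give
    \<open>q z0 = 1\<close>, so this case has to be excluded before \<open>q z0\<close> is
    used.\<close>
  have "u z0 \<noteq> 0"
  proof -
    define f where "f t = u (of_real t * z0)" for t :: real
    define f' where "f' t = z0 * u1 (of_real t * z0)" for t :: real
    \<comment> \<open>On the radius to \<open>z0\<close>, \<open>t * f' t = (q - 1) * f t\<close>
      with \<open>norm (q - 1) \<le> 3\<close>. Starting at \<open>t = 1/2\<close> allows division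
      by \<open>t\<close> and gives the constant 6.\<close>
    have "f 1 \<noteq> 0"
    proof (rule gronwall_nonzero[where a = "1/2" and f' = f' and C = 6])
      show "(f has_vector_derivative f' t) (at t)" for t
      proof -
        have "((\<lambda>t. of_real t * z0) has_vector_derivative z0) (at t)"
          by (auto intro!: derivative_eq_intros)
        from field_vector_diff_chain_at[OF this u] show ?thesis
          by (simp add: f_def[abs_def] f'_def o_def)
      qed
      show "norm (f' t) \<le> 6 * norm (f t)" if t: "1/2 < t" "t < 1" for t
      proof -
        define y where "y = of_real t * z0"
        have y: "norm y < norm z0"
          using t \<open>z0 \<noteq> 0\<close> by (simp add: y_def norm_mult)
        have "(norm (q y))\<^sup>2 \<le> 2"
          using below(2)[OF y] norm_triangle_ineq[of "(q y)\<^sup>2 - 1" 1] by (simp add: norm_power)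
        then have "norm (q y) \<le> 2"
          by - (rule power2_le_imp_le, auto)
        then have "norm (q y - 1) \<le> 3"
          using norm_triangle_ineq4[of "q y" 1] by simp
        moreover have "of_real t * f' t = (q y - 1) * f t"
          using below(1)[OF y] by (simp add: q_def f_def f'_def y_def)
        from arg_cong[OF this, of norm] have "t * norm (f' t) = norm (q y - 1) * norm (f t)"
          using t by (simp add: norm_mult)
        ultimately have "t * norm (f' t) \<le> 3 * norm (f t)"
          by (simp add: mult_right_mono)
        moreover have "1/2 * norm (f' t) \<le> t * norm (f' t)"
          using t by (intro mult_right_mono) auto
        ultimately show ?thesis by simp
      qed
      show "f (1/2) \<noteq> 0"
        unfolding f_def using \<open>z0 \<noteq> 0\<close> by (intro below(1)) (simp add: norm_mult)
    qed simp
    then show ?thesis by (simp add: f_def)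
  qed
  have boundary: "norm ((q z0)\<^sup>2 - 1) \<le> 1 \<and> 0 \<le> Re (q z0)"
  proof -
    \<comment> \<open>Points on the radius tend to \<open>z0\<close> from inside, so the strict
      inequalities there pass to weak ones at \<open>z0\<close>.\<close>
    define y where "y n = of_real (1 - inverse (real (Suc n))) * z0" for n
    have "(\<lambda>n. 1 - inverse (real (Suc n))) \<longlonglongrightarrow> 1"
      using tendsto_diff[OF tendsto_const LIMSEQ_inverse_real_of_nat, of 1] by simp
    from tendsto_mult_right[OF tendsto_of_real[OF this], of z0]
    have "y \<longlonglongrightarrow> z0" unfolding y_def by simp
    with DERIV_isCont[OF q[OF \<open>u z0 \<noteq> 0\<close>]] have lim: "(\<lambda>n. q (y n)) \<longlonglongrightarrow> q z0"
      by (rule isCont_tendsto_compose)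
    have "norm (y n) < norm z0" for n
      using \<open>z0 \<noteq> 0\<close> by (simp add: y_def norm_mult del: of_real_diff) (simp add: field_simps)
    note inside = below(2,3)[OF this]
    have "norm ((q z0)\<^sup>2 - 1) \<le> 1"
      by (rule LIMSEQ_le_const2[where X = "\<lambda>n. norm ((q (y n))\<^sup>2 - 1)"])
         (auto intro!: tendsto_intros lim less_imp_le inside)
    moreover have "0 \<le> Re (q z0)"
      by (rule LIMSEQ_le_const[where X = "\<lambda>n. Re (q (y n))"])
         (auto intro!: tendsto_intros lim less_imp_le inside)
    ultimately show ?thesis by simp
  qed
  have on_curve: "norm ((q z0)\<^sup>2 - 1) = 1"
  proof (rule ccontr)
    assume "\<not> ?thesis"
    with boundary have less: "norm ((q z0)\<^sup>2 - 1) < 1" by simp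
    \<comment> \<open>Since \<open>z0\<close> is not in \<open>A\<close>, only the condition on the
      real part can fail. But a purely imaginary \<open>q z0\<close> has a nonpositive square, at
      distance at least 1 from 1.\<close>
    with \<open>z0 \<notin> A\<close> \<open>u z0 \<noteq> 0\<close> boundary have "Re (q z0) = 0"
      by (auto simp: A_def U_def)
    then have "Re ((q z0)\<^sup>2 - 1) \<le> - 1"
      by (simp add: power2_eq_square)
    then show False
      using less abs_Re_le_cmod[of "(q z0)\<^sup>2 - 1"] by linarith
  qed
  define w where "w z = (q z)\<^sup>2 - 1" for z
  have w': "(w has_field_derivative 2 * q z * q' z) (at z)" if "u z \<noteq> 0" for z
    unfolding w_def by (auto intro!: derivative_eq_intros q that)
  have "w holomorphic_on ball 0 (norm z0)"
    by (subst holomorphic_on_open) (auto intro!: exI w' below(1))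
  moreover have "w 0 = 0" "norm (w z0) = 1"
    using \<open>q 0 = 1\<close> on_curve by (auto simp: w_def)
  ultimately obtain m where m: "m \<ge> 1" "z0 * (2 * q z0 * q' z0) = of_real m * w z0"
    using Jack[of w z0] w'[OF \<open>u z0 \<noteq> 0\<close>] below(2) unfolding w_def by metis
  \<comment> \<open>At the node 0 of the lemniscate the left side of Jack's identity would vanish,
    whereas the right side has modulus \<open>m \<ge> 1\<close>.\<close>
  have "q z0 \<noteq> 0"
    using m \<open>norm (w z0) = 1\<close> by auto
  have "z0 * q' z0 = w z0 * (of_real m / 2 * (1 / q z0))"
    using m(2) \<open>q z0 \<noteq> 0\<close> by (simp add: field_simps)
  with riccati[OF \<open>u z0 \<noteq> 0\<close>]
  have "w z0 * (1 + of_real m / 2 * (1 / q z0)) = - (c * z0 / 4) - (\<kappa> - 3) * (q z0 - 1)"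
    unfolding w_def[symmetric] by (simp add: algebra_simps eq_neg_iff_add_eq_0)
  then have "norm (1 + of_real m / 2 * (1 / q z0)) = norm (- (c * z0 / 4) - (\<kappa> - 3) * (q z0 - 1))"
    using \<open>norm (w z0) = 1\<close> by (metis mult.left_neutral norm_mult)
  also have "\<dots> \<le> norm (c * z0 / 4) + norm ((\<kappa> - 3) * (q z0 - 1))"
    by (metis norm_minus_cancel norm_triangle_ineq4)
  also have "\<dots> \<le> norm c / 4 + norm (\<kappa> - 3)"
    using \<open>norm z0 < 1\<close> lemniscate_bounds(1)[OF on_curve] boundary
    by (intro add_mono) (auto simp: norm_mult norm_divide intro!: mult_left_le)
  also have "\<dots> < 1 + 1 / (2 * sqrt 2)"
    using small by simp
  also have "\<dots> \<le> 1 + m / 2 * Re (1 / q z0)"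
    using mult_mono[of "1/2" "m/2" "1 / sqrt 2" "Re (1 / q z0)"] m(1)
      lemniscate_bounds(2)[OF on_curve] boundary \<open>q z0 \<noteq> 0\<close> by simp
  also have "\<dots> = Re (1 + of_real (m / 2) * (1 / q z0))"
    by (simp only: times_complex.sel Re_complex_of_real Im_complex_of_real mult_zero_left diff_zero plus_complex.sel one_complex.sel)
  also have "\<dots> = Re (1 + of_real m / 2 * (1 / q z0))"
    by simp
  also have "\<dots> \<le> norm (1 + of_real m / 2 * (1 / q z0))"
    by (rule complex_Re_le_cmod)
  finally show False by simp
qed

section \<open>The Bessel series and its differential equation\<close>

text \<open>Every factor has real part at least 1. This keeps the denominators of the series nonzero
  and lets the exponential series dominate it.\<close>

lemma norm_pochhammer_ge_1:
  fixes \<kappa> :: complex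
  assumes "Re \<kappa> \<ge> 1"
  shows "norm (pochhammer \<kappa> n) \<ge> 1"
proof (induction n)
  case (Suc n)
  have "1 \<le> norm (\<kappa> + of_nat n)"
    using complex_Re_le_cmod[of "\<kappa> + of_nat n"] assms by simp
  with Suc have "1 * 1 \<le> norm (pochhammer \<kappa> n) * norm (\<kappa> + of_nat n)"
    by (intro mult_mono) auto
  then show ?case by (simp add: pochhammer_Suc norm_mult)
qed simp

text \<open>Comparing coefficients of \<open>z ^ n\<close> reduces the equation to the recurrence
  \<open>(\<kappa> + n) * (n + 1) * a (n + 1) = d * a n\<close>.\<close>

lemma bessel_series_ode:
  fixes \<kappa> d :: complex
  assumes "Re \<kappa> \<ge> 1"
  defines "a \<equiv> \<lambda>n. d ^ n / pochhammer \<kappa> n / fact n"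
  defines "u \<equiv> \<lambda>z. \<Sum>n. a n * z ^ n"
  obtains u1 u2 where "\<And>z. (u has_field_derivative u1 z) (at z)"
    "\<And>z. (u1 has_field_derivative u2 z) (at z)"
    "\<And>z. z * u2 z + \<kappa> * u1 z - d * u z = 0"
proof -
  have a: "summable (\<lambda>n. a n * z ^ n)" for z
  proof (rule summable_comparison_test')
    show "summable (\<lambda>n. norm (d * z) ^ n / fact n)"
      using summable_exp[of "norm (d * z)"] by (simp add: field_simps)
    show "norm (a n * z ^ n) \<le> norm (d * z) ^ n / fact n" for n
    proof -
      have "norm (a n * z ^ n) = norm (d * z) ^ n / fact n / norm (pochhammer \<kappa> n)"
        by (simp add: a_def norm_mult norm_divide norm_power power_mult_distrib field_simps)
      also have "\<dots> \<le> norm (d * z) ^ n / fact n / 1"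
        by (intro divide_left_mono norm_pochhammer_ge_1 assms)
           (use norm_pochhammer_ge_1[OF assms(1), of n] in auto)
      finally show ?thesis by simp
    qed
  qed
  have diffs: "summable (\<lambda>n. diffs f n * z ^ n)" if "\<And>z. summable (\<lambda>n. f n * z ^ n)"
    for f :: "nat \<Rightarrow> complex" and z
    using termdiff_converges_all that by blast
  define u1 where "u1 z = (\<Sum>n. diffs a n * z ^ n)" for z
  define u2 where "u2 z = (\<Sum>n. diffs (diffs a) n * z ^ n)" for z
  note a1 = diffs[OF a]
  note a2 = diffs[OF a1]
  have "(u has_field_derivative u1 z) (at z)" for z
    unfolding u_def u1_def using termdiffs_strong_converges_everywhere[OF a] by simp
  moreover have "(u1 has_field_derivative u2 z) (at z)" for z
    unfolding u1_def u2_def using termdiffs_strong_converges_everywhere[OF a1] by simp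
  moreover have "z * u2 z + \<kappa> * u1 z - d * u z = 0" for z
  proof -
    have "(\<lambda>n. z * (diffs (diffs a) n * z ^ n)) sums (z * u2 z)"
      unfolding u2_def by (intro sums_mult summable_sums a2)
    then have "(\<lambda>n. of_nat (Suc n) * diffs a (Suc n) * z ^ Suc n) sums (z * u2 z)"
      by (simp add: diffs_def algebra_simps)
    \<comment> \<open>The factor \<open>of_nat n\<close> kills the term at \<open>n = 0\<close>, so
      the index shift adds nothing.\<close>
    then have "(\<lambda>n. of_nat n * diffs a n * z ^ n) sums (z * u2 z)"
      by (subst (asm) sums_Suc_iff) simp
    moreover have "(\<lambda>n. \<kappa> * (diffs a n * z ^ n)) sums (\<kappa> * u1 z)"
      unfolding u1_def by (intro sums_mult summable_sums a1)
    moreover have "(\<lambda>n. d * (a n * z ^ n)) sums (d * u z)"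
      unfolding u_def by (intro sums_mult summable_sums a)
    ultimately have "(\<lambda>n. of_nat n * diffs a n * z ^ n + \<kappa> * (diffs a n * z ^ n) - d * (a n * z ^ n))
        sums (z * u2 z + \<kappa> * u1 z - d * u z)"
      by (intro sums_add sums_diff)
    moreover have "of_nat n * diffs a n * z ^ n + \<kappa> * (diffs a n * z ^ n) - d * (a n * z ^ n) = 0" for n
    proof -
      \<comment> \<open>Its last factor is \<open>\<kappa> + of_nat n\<close>, so both quantities
        divided by below are nonzero.\<close>
      have "pochhammer \<kappa> (Suc n) \<noteq> 0"
        using norm_pochhammer_ge_1[OF assms(1), of "Suc n"] by auto
      then have "pochhammer \<kappa> n \<noteq> 0" "\<kappa> + of_nat n \<noteq> 0"
        by (auto simp: pochhammer_Suc)
      then have "(\<kappa> + of_nat n) * diffs a n = d * a n"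
        unfolding a_def diffs_def pochhammer_Suc fact_Suc
        by (simp add: divide_simps del: of_nat_Suc)
      then show ?thesis
        by (metis (no_types, lifting) add.commute cancel_comm_monoid_add_class.diff_cancel distrib_right mult.assoc)
    qed
    ultimately show ?thesis
      using sums_unique2 sums_zero by fastforce
  qed
  ultimately show ?thesis using that by blast
qed

section \<open>Subordination and conclusion\<close>

text \<open>The Schwarz function is \<open>q\<^sup>2 - 1\<close>; positivity of \<open>Re q\<close>
  selects the principal branch, so \<open>csqrt (q\<^sup>2) = q\<close>.\<close>

lemma subordinate_csqrt:
  assumes q: "q holomorphic_on ball 0 1" and "q 0 = 1"
    and "\<And>z. norm z < 1 \<Longrightarrow> norm ((q z)\<^sup>2 - 1) < 1 \<and> 0 < Re (q z)"
  shows "subordinate q (\<lambda>z. csqrt (1 + z))"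
proof -
  have "1 + z \<notin> \<real>\<^sub>\<le>\<^sub>0" if "norm z < 1" for z :: complex
    using that abs_Re_le_cmod[of z] by (auto simp: complex_nonpos_Reals_iff)
  then have "(\<lambda>z. csqrt (1 + z)) holomorphic_on ball 0 1"
    by (auto intro!: holomorphic_intros)
  moreover have "(\<lambda>z. (q z)\<^sup>2 - 1) holomorphic_on ball 0 1"
    by (intro holomorphic_intros q)
  ultimately show ?thesis
    unfolding subordinate_def using assms
    by (auto simp: analytic_on_open csqrt_unique intro!: exI[of _ "\<lambda>z. (q z)\<^sup>2 - 1"])
qed

theorem corollary2p4:
  fixes b p c \<kappa> :: complex
  assumes "\<kappa> = p + (b + 1) / 2"
    and "sqrt 3 * norm (\<kappa> - 3) + norm c / 4 < sqrt (9 / 8 + 1 / sqrt 2)"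
  shows "lemniscate_starlike (\<lambda>z. z * gen_bessel p b c z)"
proof -
  \<comment> \<open>The Riccati estimate uses \<open>norm (\<kappa> - 3)\<close> with coefficient 1,
    because \<open>norm (q - 1) \<le> 1\<close> on the lemniscate.\<close>
  have "norm (\<kappa> - 3) \<le> sqrt 3 * norm (\<kappa> - 3)"
    by (simp add: mult_le_cancel_right1)
  with assms(2) have small: "norm (\<kappa> - 3) + norm c / 4 < 1 + 1 / (2 * sqrt 2)"
    unfolding sqrt_bound_eq by linarith
  moreover have "1 / (2 * sqrt 2) \<le> (1::real)"
  proof -
    have "1 \<le> 2 * sqrt (2::real)"
      using real_sqrt_ge_one[of 2] by linarith
    then show ?thesis by (simp add: divide_simps)
  qed
  \<comment> \<open>This puts \<open>\<kappa>\<close> in the half-plane where the Pochhammer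
    denominators are controlled.\<close>
  ultimately have "norm (\<kappa> - 3) < 2"
    using norm_ge_zero[of c] by linarith
  then have re: "Re \<kappa> \<ge> 1"
    using abs_Re_le_cmod[of "\<kappa> - 3"] by simp
  define u where "u = gen_bessel p b c"
  have u_eq: "u = (\<lambda>z. \<Sum>n. (- c / 4) ^ n / pochhammer \<kappa> n / fact n * z ^ n)"
    unfolding u_def gen_bessel_def[abs_def] assms(1) by (simp add: algebra_simps)
  obtain u1 u2 where u: "\<And>z. (u has_field_derivative u1 z) (at z)"
    and u1: "\<And>z. (u1 has_field_derivative u2 z) (at z)"
    and ode: "\<And>z. z * u2 z + \<kappa> * u1 z - (- c / 4) * u z = 0"
    using bessel_series_ode[OF re, of "- c / 4"] unfolding u_eq by blast
  have "u 0 = 1"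
    unfolding u_eq by (subst powser_zero) simp
  \<comment> \<open>For \<open>f z = z * u z\<close> this is \<open>z * f' z / f z\<close> with the
    factor \<open>z\<close> cancelled, hence its extension across 0.\<close>
  define q where "q z = 1 + z * u1 z / u z" for z
  have q: "u z \<noteq> 0 \<and> norm ((q z)\<^sup>2 - 1) < 1 \<and> 0 < Re (q z)" if "norm z < 1" for z
    unfolding q_def using ode
    by (intro bessel_ode_lemniscate[OF u u1 _ \<open>u 0 = 1\<close> small that]) simp
  have der: "((\<lambda>z. z * u z) has_field_derivative (u z + z * u1 z)) (at z)" for z
    by (auto intro!: derivative_eq_intros u)
  have "u holomorphic_on ball 0 1" "u1 holomorphic_on ball 0 1"
    using u u1 by (auto simp: holomorphic_on_open)
  then have hol: "q holomorphic_on ball 0 1"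
    unfolding q_def using q by (auto intro!: holomorphic_intros)
  moreover have "subordinate q (\<lambda>z. csqrt (1 + z))"
    using hol q by (intro subordinate_csqrt) (auto simp: q_def)
  moreover have "(\<lambda>z. z * u z) holomorphic_on ball 0 1"
    by (intro holomorphic_intros \<open>u holomorphic_on ball 0 1\<close>)
  moreover have "q z = z * deriv (\<lambda>z. z * u z) z / (z * u z)" if "z \<in> ball 0 1 - {0}" for z
    using that q[of z] by (simp add: q_def DERIV_imp_deriv[OF der] field_simps)
  moreover have "deriv (\<lambda>z. z * u z) 0 = 1"
    using DERIV_imp_deriv[OF der, of 0] \<open>u 0 = 1\<close> by simp
  ultimately show ?thesis
    unfolding lemniscate_starlike_def u_def[symmetric] using q
    by (intro conjI exI[of _ q] ballI) (auto simp: analytic_on_open)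
qed

end
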